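(* Let $\mathrm{GHA}_f$ be the generalized Heisenberg algebra generated by $\{a,a^{\dagger},H\}$ with structure function $f$. For any positive integer $k$, $$(a^{\dagger})^{k}a^{k}=\big(a^{\dagger}a-(k-1)_{f}(H)\big)\big(a^{\dagger}a-(k-2)_{f}(H)\big)\cdots\big(a^{\dagger}a-(1)_{f}(H)\big)\,a^{\dagger}a=\prod_{l=0}^{k-1}\big(a^{\dagger}a-(l)_{f}(H)\big),$$ where $(l)_{f}(H)=H-f^{-l}(H)$.
   Context: The generalized Heisenberg algebra $\mathrm{GHA}_f$ is the algebra generated by $\{a,a^{\dagger},H\}$ (together with functions of $H$) subject to the relations $$aH=f(H)a,\qquad Ha^{\dagger}=a^{\dagger}f(H),\qquad [a,a^{\dagger}]=aa^{\dagger}-a^{\dagger}a=f(H)-H,$$ where $H$ is the self-conjugate Hamiltonian and $f(H)$ is an analytic function of $H$; $f$ is assumed to have a compositional inverse $f^{-1}$. Functions of $H$ commute with each other, and the first two relations extend to functions $g$ of $H$: $a\,g(H)=g(f(H))\,a$ and $g(H)\,a^{\dagger}=a^{\dagger}g(f(H))$. For a positive integer $k$, $f^{k}$ is the $k$-fold composition of $f$ with itself, $f^{-k}$ is the $k$-fold composition of $f^{-1}$ with itself, and $f^{0}$ is the identity function. For $k\in\mathbb{Z}$, $[k]_f(H)=f^{k}(H)-H$ and $(k)_f(H)=[k]_f(f^{-k}(H))=H-f^{-k}(H)$; in particular $(0)_f(H)=0$. The element $a^{\dagger}a$ commutes with functions of $H$, so the order of the factors in the product is irrelevant. *)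

theory Defs
  imports
    "HOL-Analysis.Complex_Analysis_Basics"
    "HOL-Library.Poly_Mapping"
    "HOL-Algebra.QuotRing"
begin

section \<open>Free associative algebras\<close>

text \<open>With lists as the free monoid, finitely supported functions on lists under the convolution
  product of \<^theory>\<open>HOL-Library.Poly_Mapping\<close> are noncommutative polynomials.\<close>

instantiation list :: (type) monoid_add
begin

definition zero_list :: "'a list" where
  "zero_list = []"

definition plus_list :: "'a list \<Rightarrow> 'a list \<Rightarrow> 'a list" where
  "plus_list xs ys = xs @ ys"

instance
  by standard (simp_all add: zero_list_def plus_list_def)

end

definition free_algebra :: "'g set \<Rightarrow> ('g list \<Rightarrow>\<^sub>0 complex) ring" where
  "free_algebra X = \<lparr>carrier = {p. Poly_Mapping.keys p \<subseteq> lists X},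
     mult = (*), one = 1, zero = 0, add = (+)\<rparr>"

definition fvar :: "'g \<Rightarrow> ('g list \<Rightarrow>\<^sub>0 complex)" where
  "fvar x = Poly_Mapping.single [x] 1"

definition fconst :: "complex \<Rightarrow> ('g list \<Rightarrow>\<^sub>0 complex)" where
  "fconst c = Poly_Mapping.single [] c"

lemma ring_free_algebra: "ring (free_algebra X)"
proof -
  have add: "Poly_Mapping.keys (p + q) \<subseteq> lists X"
    if "Poly_Mapping.keys p \<subseteq> lists X" "Poly_Mapping.keys q \<subseteq> lists X"
    for p q :: "'a list \<Rightarrow>\<^sub>0 complex"
    using that keys_add[of p q] by blast
  have mult: "Poly_Mapping.keys (p * q) \<subseteq> lists X"
    if "Poly_Mapping.keys p \<subseteq> lists X" "Poly_Mapping.keys q \<subseteq> lists X"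
    for p q :: "'a list \<Rightarrow>\<^sub>0 complex"
    using that keys_mult[of p q] by (force simp: plus_list_def)
  have one: "Poly_Mapping.keys (1 :: 'a list \<Rightarrow>\<^sub>0 complex) \<subseteq> lists X"
    by (simp add: zero_list_def)
  show ?thesis
  proof (rule ringI)
    show "abelian_group (free_algebra X)"
    proof (rule abelian_groupI)
      fix p assume "p \<in> carrier (free_algebra X)"
      then show "\<exists>q\<in>carrier (free_algebra X). q \<oplus>\<^bsub>free_algebra X\<^esub> p = \<zero>\<^bsub>free_algebra X\<^esub>"
        by (intro bexI[of _ "- p"]) (auto simp: free_algebra_def)
    qed (use add in \<open>auto simp: free_algebra_def add.assoc add.commute\<close>)
    show "Group.monoid (free_algebra X)"
      by (rule monoidI) (use mult one in \<open>auto simp: free_algebra_def mult.assoc\<close>)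
  qed (auto simp: free_algebra_def distrib_left distrib_right)
qed


section \<open>Structure function and functions of H\<close>

text \<open>
  The functions of \<open>H\<close> form a set \<open>F\<close> of complex functions on a domain \<open>D\<close> (say, an open
  set or the real line); values outside \<open>D\<close> are irrelevant. The algebra \<open>F\<close> is left
  arbitrary, subject to the closure properties that make \<open>g(f(H))\<close> and \<open>g(f\<^sup>-\<^sup>1(H))\<close>
  functions of \<open>H\<close>; \<open>fi\<close> is the compositional inverse of \<open>f\<close> on \<open>D\<close>.
\<close>

locale gha_setting =
  fixes D :: "complex set"
    and F :: "(complex \<Rightarrow> complex) set"
    and f fi :: "complex \<Rightarrow> complex"
  assumes f_analytic: "f analytic_on D"
    and f_maps: "f ` D \<subseteq> D"
    and fi_maps: "fi ` D \<subseteq> D"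
    and fi_f: "x \<in> D \<Longrightarrow> fi (f x) = x"
    and f_fi: "x \<in> D \<Longrightarrow> f (fi x) = x"
    and F_id: "(\<lambda>x. x) \<in> F"
    and F_const: "(\<lambda>_. c) \<in> F"
    and F_add: "g \<in> F \<Longrightarrow> h \<in> F \<Longrightarrow> (\<lambda>x. g x + h x) \<in> F"
    and F_mult: "g \<in> F \<Longrightarrow> h \<in> F \<Longrightarrow> (\<lambda>x. g x * h x) \<in> F"
    and F_comp_f: "g \<in> F \<Longrightarrow> (\<lambda>x. g (f x)) \<in> F"
    and F_comp_fi: "g \<in> F \<Longrightarrow> (\<lambda>x. g (fi x)) \<in> F"

lemma gha_setting_analytic:
  assumes "f analytic_on D" "fi analytic_on D" "f ` D \<subseteq> D" "fi ` D \<subseteq> D"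
    and "\<And>x. x \<in> D \<Longrightarrow> fi (f x) = x" "\<And>x. x \<in> D \<Longrightarrow> f (fi x) = x"
  shows "gha_setting D {g. g analytic_on D} f fi"
proof
  fix g assume g: "g \<in> {g. g analytic_on D}"
  show "(\<lambda>x. g (f x)) \<in> {g. g analytic_on D}"
    using analytic_on_compose[OF assms(1), of g] g assms(3)
      analytic_on_subset[of g D "f ` D"] by (simp add: o_def)
  show "(\<lambda>x. g (fi x)) \<in> {g. g analytic_on D}"
    using analytic_on_compose[OF assms(2), of g] g assms(4)
      analytic_on_subset[of g D "fi ` D"] by (simp add: o_def)
qed (use assms in \<open>auto intro: analytic_intros\<close>)

definition fpow :: "(complex \<Rightarrow> complex) \<Rightarrow> (complex \<Rightarrow> complex) \<Rightarrow> int \<Rightarrow> complex \<Rightarrow> complex" where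
  "fpow f fi k = (if k \<ge> 0 then f ^^ nat k else fi ^^ nat (- k))"

text \<open>\<open>[k]\<^sub>f\<close> and \<open>(k)\<^sub>f\<close>\<close>

definition fbracket :: "(complex \<Rightarrow> complex) \<Rightarrow> (complex \<Rightarrow> complex) \<Rightarrow> int \<Rightarrow> complex \<Rightarrow> complex" where
  "fbracket f fi k x = fpow f fi k x - x"

definition fparen :: "(complex \<Rightarrow> complex) \<Rightarrow> (complex \<Rightarrow> complex) \<Rightarrow> int \<Rightarrow> complex \<Rightarrow> complex" where
  "fparen f fi k x = fbracket f fi k (fpow f fi (- k) x)"

context gha_setting
begin

lemma fi_funpow_in: "x \<in> D \<Longrightarrow> (fi ^^ n) x \<in> D"
  by (induction n) (use fi_maps in auto)

lemma f_funpow_in: "x \<in> D \<Longrightarrow> (f ^^ n) x \<in> D"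
  by (induction n) (use f_maps in auto)

lemma f_fi_funpow: "x \<in> D \<Longrightarrow> (f ^^ n) ((fi ^^ n) x) = x"
proof (induction n)
  case (Suc n)
  have "(f ^^ Suc n) ((fi ^^ Suc n) x) = (f ^^ n) (f (fi ((fi ^^ n) x)))"
    by (simp add: funpow_swap1)
  then show ?case using Suc f_fi fi_funpow_in by simp
qed simp

lemma fi_f_funpow: "x \<in> D \<Longrightarrow> (fi ^^ n) ((f ^^ n) x) = x"
proof (induction n)
  case (Suc n)
  have "(fi ^^ Suc n) ((f ^^ Suc n) x) = (fi ^^ n) (fi (f ((f ^^ n) x)))"
    by (simp add: funpow_swap1)
  then show ?case using Suc fi_f f_funpow_in by simp
qed simp

lemma fparen_eq: "x \<in> D \<Longrightarrow> fparen f fi k x = x - fpow f fi (- k) x"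
  by (auto simp: fparen_def fbracket_def fpow_def f_fi_funpow fi_f_funpow)

lemma F_fpow: "fpow f fi k \<in> F"
proof -
  have "f ^^ n \<in> F" for n
  proof (induction n)
    case (Suc n)
    show ?case using F_comp_f[OF Suc] by (simp add: o_def funpow_Suc_right del: funpow.simps)
  qed (use F_id in \<open>simp add: id_def\<close>)
  moreover have "fi ^^ n \<in> F" for n
  proof (induction n)
    case (Suc n)
    show ?case using F_comp_fi[OF Suc] by (simp add: o_def funpow_Suc_right del: funpow.simps)
  qed (use F_id in \<open>simp add: id_def\<close>)
  ultimately show ?thesis by (simp add: fpow_def)
qed

lemma F_comp_fpow:
  assumes g: "g \<in> F" shows "(\<lambda>x. g (fpow f fi k x)) \<in> F"
proof -
  have "(\<lambda>x. g ((f ^^ n) x)) \<in> F" for n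
  proof (induction n)
    case (Suc n)
    show ?case using F_comp_f[OF Suc] by (simp add: funpow_swap1)
  qed (use g in simp)
  moreover have "(\<lambda>x. g ((fi ^^ n) x)) \<in> F" for n
  proof (induction n)
    case (Suc n)
    show ?case using F_comp_fi[OF Suc] by (simp add: funpow_swap1)
  qed (use g in simp)
  ultimately show ?thesis by (simp add: fpow_def)
qed

lemma F_fparen: "fparen f fi k \<in> F"
proof -
  have "(\<lambda>x. fpow f fi k x + (- 1) * x) \<in> F"
    using F_add[OF F_fpow[of k] F_mult[OF F_const[of "- 1"] F_id]] .
  from F_comp_fpow[OF this, of "- k"] show ?thesis
    by (simp add: fparen_def[abs_def] fbracket_def)
qed

end


section \<open>The generalized Heisenberg algebra\<close>

datatype gha_gen = Lower | Raise | Fun "complex \<Rightarrow> complex"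

text \<open>
  \<open>Lower\<close>, \<open>Raise\<close> and \<open>Fun g\<close> stand for \<open>a\<close>, \<open>a\<^sup>\<dagger>\<close> and \<open>g(H)\<close>; in particular
  \<open>H\<close> is \<open>Fun (\<lambda>x. x)\<close>. An element \<open>u - v\<close> below imposes the relation \<open>u = v\<close>. The first
  four rules turn \<open>g \<mapsto> g(H)\<close> into a unital algebra homomorphism on \<open>F\<close> that sees only
  the values on \<open>D\<close>. The relations between \<open>a\<close>, \<open>a\<^sup>\<dagger>\<close> and \<open>H\<close> alone are the instances
  \<open>g = (\<lambda>x. x)\<close> of \<open>lower_fun\<close> and \<open>fun_raise\<close>; for a function \<open>g\<close> that is not a polynomial
  the general form has to be imposed.
\<close>

inductive_set gha_relators ::
    "complex set \<Rightarrow> (complex \<Rightarrow> complex) set \<Rightarrow> (complex \<Rightarrow> complex) \<Rightarrow> (gha_gen list \<Rightarrow>\<^sub>0 complex) set"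
  for D :: "complex set" and F :: "(complex \<Rightarrow> complex) set" and f :: "complex \<Rightarrow> complex"
where
  fun_cong: "g \<in> F \<Longrightarrow> h \<in> F \<Longrightarrow> (\<And>x. x \<in> D \<Longrightarrow> g x = h x) \<Longrightarrow>
      fvar (Fun g) - fvar (Fun h) \<in> gha_relators D F f"
| fun_const: "fvar (Fun (\<lambda>_. c)) - fconst c \<in> gha_relators D F f"
| fun_add: "g \<in> F \<Longrightarrow> h \<in> F \<Longrightarrow>
      fvar (Fun (\<lambda>x. g x + h x)) - (fvar (Fun g) + fvar (Fun h)) \<in> gha_relators D F f"
| fun_mult: "g \<in> F \<Longrightarrow> h \<in> F \<Longrightarrow>
      fvar (Fun (\<lambda>x. g x * h x)) - fvar (Fun g) * fvar (Fun h) \<in> gha_relators D F f"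
| lower_fun: "g \<in> F \<Longrightarrow>
      fvar Lower * fvar (Fun g) - fvar (Fun (\<lambda>x. g (f x))) * fvar Lower \<in> gha_relators D F f"
| fun_raise: "g \<in> F \<Longrightarrow>
      fvar (Fun g) * fvar Raise - fvar Raise * fvar (Fun (\<lambda>x. g (f x))) \<in> gha_relators D F f"
| commutator: "(fvar Lower * fvar Raise - fvar Raise * fvar Lower)
      - (fvar (Fun f) - fvar (Fun (\<lambda>x. x))) \<in> gha_relators D F f"

definition gha_free :: "(complex \<Rightarrow> complex) set \<Rightarrow> (gha_gen list \<Rightarrow>\<^sub>0 complex) ring" where
  "gha_free F = free_algebra ({Lower, Raise} \<union> Fun ` F)"

definition gha_ideal ::
    "complex set \<Rightarrow> (complex \<Rightarrow> complex) set \<Rightarrow> (complex \<Rightarrow> complex) \<Rightarrow> (gha_gen list \<Rightarrow>\<^sub>0 complex) set" where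
  "gha_ideal D F f = Idl\<^bsub>gha_free F\<^esub> (gha_relators D F f)"

definition GHA ::
    "complex set \<Rightarrow> (complex \<Rightarrow> complex) set \<Rightarrow> (complex \<Rightarrow> complex) \<Rightarrow> (gha_gen list \<Rightarrow>\<^sub>0 complex) set ring" where
  "GHA D F f = gha_free F Quot gha_ideal D F f"

definition gha_class ::
    "complex set \<Rightarrow> (complex \<Rightarrow> complex) set \<Rightarrow> (complex \<Rightarrow> complex) \<Rightarrow>
     (gha_gen list \<Rightarrow>\<^sub>0 complex) \<Rightarrow> (gha_gen list \<Rightarrow>\<^sub>0 complex) set" where
  "gha_class D F f p = gha_ideal D F f +>\<^bsub>gha_free F\<^esub> p"

definition gha_a ::
    "complex set \<Rightarrow> (complex \<Rightarrow> complex) set \<Rightarrow> (complex \<Rightarrow> complex) \<Rightarrow> (gha_gen list \<Rightarrow>\<^sub>0 complex) set" where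
  "gha_a D F f = gha_class D F f (fvar Lower)"

definition gha_adag ::
    "complex set \<Rightarrow> (complex \<Rightarrow> complex) set \<Rightarrow> (complex \<Rightarrow> complex) \<Rightarrow> (gha_gen list \<Rightarrow>\<^sub>0 complex) set" where
  "gha_adag D F f = gha_class D F f (fvar Raise)"

definition gha_fun ::
    "complex set \<Rightarrow> (complex \<Rightarrow> complex) set \<Rightarrow> (complex \<Rightarrow> complex) \<Rightarrow>
     (complex \<Rightarrow> complex) \<Rightarrow> (gha_gen list \<Rightarrow>\<^sub>0 complex) set" where
  "gha_fun D F f g = gha_class D F f (fvar (Fun g))"

text \<open>\<open>a\<^sup>\<dagger>a - (l)\<^sub>f(H)\<close>\<close>

definition gha_factor ::
    "complex set \<Rightarrow> (complex \<Rightarrow> complex) set \<Rightarrow> (complex \<Rightarrow> complex) \<Rightarrow> (complex \<Rightarrow> complex) \<Rightarrow>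
     int \<Rightarrow> (gha_gen list \<Rightarrow>\<^sub>0 complex) set" where
  "gha_factor D F f fi l =
     (gha_adag D F f \<otimes>\<^bsub>GHA D F f\<^esub> gha_a D F f) \<ominus>\<^bsub>GHA D F f\<^esub> gha_fun D F f (fparen f fi l)"

text \<open>Since \<^const>\<open>finprod\<close> is for commutative monoids, products in a noncommutative ring are taken
  over lists, leftmost factor first.\<close>

definition list_prod :: "('a, 'b) ring_scheme \<Rightarrow> 'a list \<Rightarrow> 'a" where
  "list_prod R xs = foldr (\<otimes>\<^bsub>R\<^esub>) xs \<one>\<^bsub>R\<^esub>"

context gha_setting
begin

lemma ring_gha_free: "ring (gha_free F)"
  by (simp add: gha_free_def ring_free_algebra)

lemma gha_relators_carrier: "gha_relators D F f \<subseteq> carrier (gha_free F)"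
proof -
  let ?R = "gha_free F"
  interpret ring ?R by (rule ring_gha_free)
  have v: "fvar Lower \<in> carrier ?R" "fvar Raise \<in> carrier ?R"
      "\<And>g. g \<in> F \<Longrightarrow> fvar (Fun g) \<in> carrier ?R" "\<And>c. fconst c \<in> carrier ?R"
    by (auto simp: gha_free_def free_algebra_def fvar_def fconst_def)
  have plus: "p + q \<in> carrier ?R" and times: "p * q \<in> carrier ?R" and minus: "p - q \<in> carrier ?R"
    if "p \<in> carrier ?R" "q \<in> carrier ?R" for p q
  proof -
    show "p + q \<in> carrier ?R" "p * q \<in> carrier ?R"
      using a_closed[OF that] m_closed[OF that] by (simp_all add: gha_free_def free_algebra_def)
    have "- q \<in> carrier ?R" using that by (simp add: gha_free_def free_algebra_def)
    from a_closed[OF that(1) this] show "p - q \<in> carrier ?R"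
      by (simp add: gha_free_def free_algebra_def)
  qed
  have f: "f \<in> F" using F_comp_f[OF F_id] by simp
  show ?thesis
  proof
    fix p assume "p \<in> gha_relators D F f"
    then show "p \<in> carrier ?R"
      by induction (intro plus times minus v f F_id F_const F_add F_mult F_comp_f; assumption)+
  qed
qed

lemma ideal_gha_ideal: "ideal (gha_ideal D F f) (gha_free F)"
  unfolding gha_ideal_def by (rule ring.genideal_ideal[OF ring_gha_free gha_relators_carrier])

lemma ring_GHA: "ring (GHA D F f)"
  unfolding GHA_def by (rule ideal.quotient_is_ring[OF ideal_gha_ideal])

end

end

theory Submission
  imports Defs
begin

text \<open>
  Write \<open>L l = a\<^sup>\<dagger>a - (l)\<^sub>f(H)\<close>. The proof rests on the intertwining relation
  \<open>L (l + 1) a\<^sup>\<dagger> = a\<^sup>\<dagger> L l\<close>. Indeed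
  \<open>a\<^sup>\<dagger>a a\<^sup>\<dagger> = a\<^sup>\<dagger> (a\<^sup>\<dagger>a + f(H) - H)\<close> by the commutator, while moving
  \<open>(l + 1)\<^sub>f(H)\<close> to the right of \<open>a\<^sup>\<dagger>\<close> precomposes it with \<open>f\<close> and
  \<open>f(x) - f\<^sup>-\<^sup>l\<^sup>-\<^sup>1(f(x)) = (f(x) - x) + (x - f\<^sup>-\<^sup>l(x))\<close>; the two terms
  \<open>f(H) - H\<close> cancel (\<open>gha_factor_raise\<close>).

  Now write \<open>(a\<^sup>\<dagger>)\<^sup>k\<^sup>+\<^sup>1 a\<^sup>k\<^sup>+\<^sup>1\<close> as \<open>a\<^sup>\<dagger> ((a\<^sup>\<dagger>)\<^sup>k a\<^sup>k) a\<close>. If the inner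
  factor is \<open>L (k - 1) \<cdots> L 0\<close>, pulling \<open>a\<^sup>\<dagger>\<close> through it raises every index by one and leaves
  \<open>a\<^sup>\<dagger>a = L 0\<close> at the right end, which is the product for \<open>k + 1\<close>
  (\<open>pow_mult_pow_eq_list_prod\<close>). Finally \<open>a\<^sup>\<dagger>a\<close> commutes with functions of \<open>H\<close>, so
  the factors commute pairwise and their order is irrelevant (\<open>list_prod_mset_cong\<close>).
\<close>

section \<open>Products over lists in a noncommutative ring\<close>

context ring
begin

lemma diff_add_cancel_right:
  assumes "x \<in> carrier R" "y \<in> carrier R" "z \<in> carrier R"
  shows "(x \<oplus> z) \<ominus> (y \<oplus> z) = x \<ominus> y"
proof -
  have "(x \<oplus> z) \<ominus> (y \<oplus> z) = (x \<ominus> y) \<oplus> (z \<oplus> \<ominus> z)"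
    using assms by (simp only: minus_eq minus_add a_ac a_closed a_inv_closed)
  then show ?thesis
    using assms by (simp add: r_neg)
qed

lemma list_prod_Nil [simp]: "list_prod R [] = \<one>"
  by (simp add: list_prod_def)

lemma list_prod_Cons [simp]: "list_prod R (x # xs) = x \<otimes> list_prod R xs"
  by (simp add: list_prod_def)

lemma list_prod_closed [simp, intro]: "set xs \<subseteq> carrier R \<Longrightarrow> list_prod R xs \<in> carrier R"
  by (induction xs) auto

lemma list_prod_append:
  "set xs \<subseteq> carrier R \<Longrightarrow> set ys \<subseteq> carrier R \<Longrightarrow>
    list_prod R (xs @ ys) = list_prod R xs \<otimes> list_prod R ys"
  by (induction xs) (auto simp: m_assoc)

text \<open>
  The case \<open>M = L\<close> says that an element commuting with every factor commutes with the product; for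
  \<open>M i = L (i + 1)\<close> the element shifts the indices of the factors.
\<close>

lemma list_prod_intertwine:
  assumes "b \<in> carrier R" "L \<in> I \<rightarrow> carrier R" "M \<in> I \<rightarrow> carrier R" "set is \<subseteq> I"
    and "\<And>i. i \<in> I \<Longrightarrow> M i \<otimes> b = b \<otimes> L i"
  shows "b \<otimes> list_prod R (map L is) = list_prod R (map M is) \<otimes> b"
  using assms(4)
proof (induction "is")
  case Nil
  then show ?case using assms(1) by simp
next
  case (Cons i "is")
  let ?P = "list_prod R (map L is)" and ?Q = "list_prod R (map M is)"
  have c: "L i \<in> carrier R" "M i \<in> carrier R" "?P \<in> carrier R" "?Q \<in> carrier R"
    using assms(2,3) Cons.prems by (auto simp: Pi_iff subset_iff intro!: list_prod_closed)
  have "b \<otimes> (L i \<otimes> ?P) = (M i \<otimes> b) \<otimes> ?P"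
    using c assms(1,5) Cons.prems by (simp flip: m_assoc)
  also have "\<dots> = M i \<otimes> (?Q \<otimes> b)"
    using c assms(1) Cons by (simp add: m_assoc)
  finally show ?case using c assms(1) by (simp add: m_assoc)
qed

text \<open>
  The head of the first list occurs somewhere in the second and can be moved to its front past the
  entries before it; induction takes care of the remaining entries.
\<close>

lemma list_prod_mset_cong:
  assumes "mset xs = mset ys" "set xs \<subseteq> carrier R"
    and "\<And>x y. x \<in> set xs \<Longrightarrow> y \<in> set xs \<Longrightarrow> x \<otimes> y = y \<otimes> x"
  shows "list_prod R xs = list_prod R ys"
  using assms
proof (induction xs arbitrary: ys)
  case Nil
  then show ?case by simp
next
  case (Cons x xs)
  then have "x \<in> set ys"
    by (metis list.set_intros(1) mset_eq_setD)
  then obtain us vs where ys: "ys = us @ x # vs"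
    by (meson split_list)
  have mset: "mset xs = mset (us @ vs)"
    using Cons.prems(1) ys by simp
  have sub: "set us \<subseteq> set (x # xs)" "set us \<subseteq> carrier R" "set vs \<subseteq> carrier R" "x \<in> carrier R"
    using mset_eq_setD[OF Cons.prems(1)] Cons.prems(2) unfolding ys by auto
  have "x \<otimes> list_prod R (map (\<lambda>y. y) us) = list_prod R (map (\<lambda>y. y) us) \<otimes> x"
    by (rule list_prod_intertwine[where I = "set us"]) (use sub Cons.prems(3) in auto)
  then have comm: "x \<otimes> list_prod R us = list_prod R us \<otimes> x"
    by simp
  have "list_prod R xs = list_prod R (us @ vs)"
    by (rule Cons.IH[OF mset]) (use Cons.prems in auto)
  then have "list_prod R (x # xs) = (x \<otimes> list_prod R us) \<otimes> list_prod R vs"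
    using sub by (simp add: list_prod_append m_assoc)
  also have "\<dots> = list_prod R ys"
    unfolding comm using sub by (simp add: ys list_prod_append m_assoc)
  finally show ?case .
qed

text \<open>
  In \<open>b\<^sup>k\<^sup>+\<^sup>1 a\<^sup>k\<^sup>+\<^sup>1 = b (b\<^sup>k a\<^sup>k) a\<close>, moving the outer \<open>b\<close> to the right through
  \<open>L (k - 1) \<cdots> L 0\<close> shifts every index up by one and sets \<open>b\<close> next to \<open>a\<close>, where
  \<open>b a = L 0\<close> supplies the missing last factor.
\<close>

lemma pow_mult_pow_eq_list_prod:
  fixes L :: "nat \<Rightarrow> 'a" and k :: nat
  assumes a: "a \<in> carrier R" and b: "b \<in> carrier R" and L: "\<And>l. L l \<in> carrier R"
    and L0: "L 0 = b \<otimes> a" and shift: "\<And>l. L (Suc l) \<otimes> b = b \<otimes> L l"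
  shows "(b [^] k) \<otimes> (a [^] k) = list_prod R (map L (rev [0..<k]))"
proof (induction k)
  case 0
  then show ?case by simp
next
  case (Suc k)
  let ?P = "list_prod R (map L (rev [0..<k]))"
  let ?Q = "list_prod R (map L (rev [1..<Suc k]))"
  have c: "?P \<in> carrier R" "?Q \<in> carrier R"
    using L by (auto intro!: list_prod_closed simp del: upt_Suc)
  have "b \<otimes> ?P = list_prod R (map (\<lambda>l. L (Suc l)) (rev [0..<k])) \<otimes> b"
    by (rule list_prod_intertwine[where I = UNIV]) (use b L shift in auto)
  also have "map (\<lambda>l. L (Suc l)) (rev [0..<k]) = map L (rev (map Suc [0..<k]))"
    by (simp add: rev_map)
  also have "map Suc [0..<k] = [1..<Suc k]"
    by (simp add: map_Suc_upt)
  finally have pull: "b \<otimes> ?P = ?Q \<otimes> b" .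
  have "(b [^] Suc k) \<otimes> (a [^] Suc k) = b \<otimes> ((b [^] k) \<otimes> (a [^] k)) \<otimes> a"
    using a b by (simp only: nat_pow_Suc2[OF b] nat_pow_Suc[of a] m_assoc m_closed nat_pow_closed)
  also have "\<dots> = ?Q \<otimes> L 0"
    using a b c by (simp add: Suc pull L0 m_assoc)
  also have "\<dots> = list_prod R (map L (rev [1..<Suc k] @ [0]))"
    using L by (subst map_append, subst list_prod_append) auto
  also have "rev [1..<Suc k] @ [0] = rev [0..<Suc k]"
    by (simp add: upt_rec[of 0 "Suc k"] del: upt_Suc)
  finally show ?case .
qed

end


section \<open>Relations in the generalized Heisenberg algebra\<close>

context gha_setting
begin

sublocale GHA: ring "GHA D F f"
  by (rule ring_GHA)

abbreviation gha_mult (infixl "\<odot>" 70) where "x \<odot> y \<equiv> x \<otimes>\<^bsub>GHA D F f\<^esub> y"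
abbreviation gha_plus (infixl "\<boxplus>" 65) where "x \<boxplus> y \<equiv> x \<oplus>\<^bsub>GHA D F f\<^esub> y"
abbreviation gha_diff (infixl "\<boxminus>" 65) where "x \<boxminus> y \<equiv> x \<ominus>\<^bsub>GHA D F f\<^esub> y"
abbreviation "A \<equiv> gha_a D F f"
abbreviation "B \<equiv> gha_adag D F f"
abbreviation "\<Phi> \<equiv> gha_fun D F f"
abbreviation "cls \<equiv> gha_class D F f"
abbreviation "free \<equiv> carrier (gha_free F)"

lemma f_in_F: "f \<in> F"
  using F_comp_f[OF F_id] by simp

lemma free_gens [simp]:
  "fvar Lower \<in> free" "fvar Raise \<in> free" "g \<in> F \<Longrightarrow> fvar (Fun g) \<in> free" "fconst c \<in> free"
  by (auto simp: gha_free_def free_algebra_def fvar_def fconst_def)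

lemma free_mult [simp]: "p \<in> free \<Longrightarrow> q \<in> free \<Longrightarrow> p * q \<in> free"
  using ring.ring_simprules(5)[OF ring_gha_free, of p q] by (simp add: gha_free_def free_algebra_def)

lemma free_add [simp]: "p \<in> free \<Longrightarrow> q \<in> free \<Longrightarrow> p + q \<in> free"
  using ring.ring_simprules(1)[OF ring_gha_free, of p q] by (simp add: gha_free_def free_algebra_def)

lemma cls_ring_hom: "cls \<in> ring_hom (gha_free F) (GHA D F f)"
  using ideal.rcos_ring_hom[OF ideal_gha_ideal]
  by (simp add: GHA_def gha_class_def[abs_def])

lemma cls_closed [simp]: "p \<in> free \<Longrightarrow> cls p \<in> carrier (GHA D F f)"
  using ring_hom_closed[OF cls_ring_hom] .

lemma cls_mult: "p \<in> free \<Longrightarrow> q \<in> free \<Longrightarrow> cls (p * q) = cls p \<odot> cls q"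
  using ring_hom_mult[OF cls_ring_hom, of p q] by (simp add: gha_free_def free_algebra_def)

lemma cls_add: "p \<in> free \<Longrightarrow> q \<in> free \<Longrightarrow> cls (p + q) = cls p \<boxplus> cls q"
  using ring_hom_add[OF cls_ring_hom, of p q] by (simp add: gha_free_def free_algebra_def)

lemma cls_relator:
  assumes "r \<in> gha_relators D F f"
  shows "cls r = \<zero>\<^bsub>GHA D F f\<^esub>"
proof -
  interpret I: ideal "gha_ideal D F f" "gha_free F" by (rule ideal_gha_ideal)
  have "r \<in> gha_ideal D F f"
    using ring.genideal_self[OF ring_gha_free gha_relators_carrier] assms
    by (auto simp: gha_ideal_def)
  then show ?thesis
    using I.a_rcos_const by (simp add: gha_class_def GHA_def FactRing_def)
qed

lemma cls_eqI:
  assumes "p - q \<in> gha_relators D F f" "q \<in> free"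
  shows "cls p = cls q"
proof -
  have "p - q \<in> free" using assms(1) gha_relators_carrier by blast
  then have "cls ((p - q) + q) = cls (p - q) \<boxplus> cls q"
    using assms(2) cls_add by blast
  then show ?thesis using assms by (simp add: cls_relator)
qed

lemma gha_gens_closed [simp]:
  "A \<in> carrier (GHA D F f)" "B \<in> carrier (GHA D F f)" "g \<in> F \<Longrightarrow> \<Phi> g \<in> carrier (GHA D F f)"
  by (simp_all add: gha_a_def gha_adag_def gha_fun_def)

lemma gha_fun_cong: "g \<in> F \<Longrightarrow> h \<in> F \<Longrightarrow> (\<And>x. x \<in> D \<Longrightarrow> g x = h x) \<Longrightarrow> \<Phi> g = \<Phi> h"
  unfolding gha_fun_def by (intro cls_eqI gha_relators.fun_cong) auto

lemma gha_fun_add: "g \<in> F \<Longrightarrow> h \<in> F \<Longrightarrow> \<Phi> (\<lambda>x. g x + h x) = \<Phi> g \<boxplus> \<Phi> h"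
  using cls_eqI[OF gha_relators.fun_add, of g h] by (simp add: gha_fun_def cls_add)

lemma gha_fun_mult: "g \<in> F \<Longrightarrow> h \<in> F \<Longrightarrow> \<Phi> (\<lambda>x. g x * h x) = \<Phi> g \<odot> \<Phi> h"
  using cls_eqI[OF gha_relators.fun_mult, of g h] by (simp add: gha_fun_def cls_mult)

lemma gha_fun_zero: "\<Phi> (\<lambda>_. 0) = \<zero>\<^bsub>GHA D F f\<^esub>"
proof -
  have "\<Phi> (\<lambda>_. 0) \<boxplus> \<Phi> (\<lambda>_. 0) = \<Phi> (\<lambda>_. 0)"
    using gha_fun_add[OF F_const[of 0] F_const[of 0]] by simp
  then show ?thesis using F_const by simp
qed

lemma gha_fun_comm: "g \<in> F \<Longrightarrow> h \<in> F \<Longrightarrow> \<Phi> g \<odot> \<Phi> h = \<Phi> h \<odot> \<Phi> g"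
  using gha_fun_mult[of g h] gha_fun_mult[of h g] by (simp add: mult.commute)

lemma gha_lower_fun: "g \<in> F \<Longrightarrow> A \<odot> \<Phi> g = \<Phi> (\<lambda>x. g (f x)) \<odot> A"
  using cls_eqI[OF gha_relators.lower_fun, of g] F_comp_f[of g]
  by (simp add: gha_fun_def gha_a_def cls_mult)

lemma gha_fun_raise: "g \<in> F \<Longrightarrow> \<Phi> g \<odot> B = B \<odot> \<Phi> (\<lambda>x. g (f x))"
  using cls_eqI[OF gha_relators.fun_raise, of g] F_comp_f[of g]
  by (simp add: gha_fun_def gha_adag_def cls_mult)

text \<open>
  The commutator relation with every term moved to the side where it has a positive sign, which is
  how it follows from additivity of the quotient map.
\<close>

lemma gha_commutator: "A \<odot> B \<boxplus> \<Phi> (\<lambda>x. x) = B \<odot> A \<boxplus> \<Phi> f"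
proof -
  let ?r = "(fvar Lower * fvar Raise - fvar Raise * fvar Lower) - (fvar (Fun f) - fvar (Fun (\<lambda>x. x)))"
  have r: "?r \<in> gha_relators D F f" by (rule gha_relators.commutator)
  then have "?r \<in> free" using gha_relators_carrier by blast
  moreover have "fvar Lower * fvar Raise + fvar (Fun (\<lambda>x. x))
      = ?r + (fvar Raise * fvar Lower + fvar (Fun f))"
    by (simp add: algebra_simps)
  ultimately have "cls (fvar Lower * fvar Raise + fvar (Fun (\<lambda>x. x)))
      = cls (fvar Raise * fvar Lower + fvar (Fun f))"
    using f_in_F by (simp only: cls_add cls_relator[OF r] free_add free_mult free_gens)
      (simp add: cls_add)
  then show ?thesis
    using f_in_F F_id by (simp add: gha_a_def gha_adag_def gha_fun_def cls_add cls_mult)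
qed

text \<open>
  Passing \<open>g(H)\<close> leftwards through \<open>a\<close> precomposes \<open>g\<close> with \<open>f\<close>, and passing it through
  \<open>a\<^sup>\<dagger>\<close> undoes this.
\<close>

lemma gha_number_fun_comm:
  assumes "g \<in> F"
  shows "(B \<odot> A) \<odot> \<Phi> g = \<Phi> g \<odot> (B \<odot> A)"
  using assms F_comp_f[OF assms]
  by (metis GHA.m_assoc gha_fun_raise gha_gens_closed gha_lower_fun)


section \<open>The factors of the product\<close>

abbreviation "L l \<equiv> gha_factor D F f fi (int l)"

lemma gha_factor_closed [simp]: "L l \<in> carrier (GHA D F f)"
  using F_fparen by (simp add: gha_factor_def)

lemma gha_factor_0: "L 0 = B \<odot> A"
proof -
  have "\<Phi> (fparen f fi 0) = \<Phi> (\<lambda>_. 0)"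
    by (rule gha_fun_cong) (simp_all add: F_fparen F_const fparen_eq fpow_def)
  then show ?thesis
    by (simp add: gha_factor_def gha_fun_zero GHA.minus_eq)
qed

lemma gha_factor_comm: "L i \<odot> L j = L j \<odot> L i"
proof -
  let ?x = "\<Phi> (fparen f fi (int i))" and ?y = "\<Phi> (fparen f fi (int j))"
  have c: "?x \<in> carrier (GHA D F f)" "?y \<in> carrier (GHA D F f)" by (simp_all add: F_fparen)
  have "(B \<odot> A) \<odot> ?x = ?x \<odot> (B \<odot> A)" "(B \<odot> A) \<odot> ?y = ?y \<odot> (B \<odot> A)" "?x \<odot> ?y = ?y \<odot> ?x"
    by (simp_all add: gha_number_fun_comm gha_fun_comm F_fparen)
  moreover have "(n \<boxminus> x) \<odot> (n \<boxminus> y) = (n \<boxminus> y) \<odot> (n \<boxminus> x)"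
    if "n \<in> carrier (GHA D F f)" "x \<in> carrier (GHA D F f)" "y \<in> carrier (GHA D F f)"
      "n \<odot> x = x \<odot> n" "n \<odot> y = y \<odot> n" "x \<odot> y = y \<odot> x" for n x y
    using that by (simp add: GHA.minus_eq GHA.l_distr GHA.r_distr GHA.l_minus GHA.r_minus
        GHA.minus_add GHA.a_ac)
  ultimately show ?thesis
    using c unfolding gha_factor_def by simp
qed

text \<open>
  Since \<open>(l + 1)\<^sub>f(f(x)) = (l)\<^sub>f(x) + f(x) - x\<close> on \<open>D\<close>, the shift of the subtracted function
  is \<open>f(H) - H\<close>, exactly the commutator picked up by \<open>a\<^sup>\<dagger>a\<close>.
\<close>

lemma gha_factor_raise: "L (Suc l) \<odot> B = B \<odot> L l"
proof -
  let ?g = "\<lambda>x. fparen f fi (int (Suc l)) (f x)"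
  let ?p = "fparen f fi (int l)"
  have F: "?g \<in> F" "?p \<in> F" by (simp_all add: F_fparen F_comp_f)
  have "fpow f fi (- int (Suc l)) (f x) = fpow f fi (- int l) x" if "x \<in> D" for x
  proof -
    have "fpow f fi (- int (Suc l)) (f x) = (fi ^^ l) (fi (f x))"
      unfolding fpow_def by (simp add: funpow_swap1 nat_add_distrib)
    also have "\<dots> = fpow f fi (- int l) x"
      using that by (auto simp: fi_f fpow_def)
    finally show ?thesis .
  qed
  then have "\<Phi> (\<lambda>x. ?g x + x) = \<Phi> (\<lambda>x. ?p x + f x)"
    using f_maps by (intro gha_fun_cong F_add F F_id f_in_F) (auto simp: fparen_eq)
  then have fun_shift: "\<Phi> ?g \<boxplus> \<Phi> (\<lambda>x. x) = \<Phi> ?p \<boxplus> \<Phi> f"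
    using gha_fun_add F F_id f_in_F by metis
  have "L (Suc l) \<odot> B = B \<odot> (A \<odot> B \<boxminus> \<Phi> ?g)"
    using F F_fparen[of "int (Suc l)"] gha_fun_raise[OF F_fparen, of "int (Suc l)"]
    by (simp add: gha_factor_def GHA.minus_eq GHA.l_distr GHA.r_distr GHA.l_minus GHA.r_minus
        GHA.m_assoc)
  \<comment> \<open>Adding \<open>H\<close> on both sides of the difference makes the commutator and the function shift
    apply; each then contributes \<open>f(H)\<close>, and these cancel.\<close>
  also have "A \<odot> B \<boxminus> \<Phi> ?g = (A \<odot> B \<boxplus> \<Phi> (\<lambda>x. x)) \<boxminus> (\<Phi> ?g \<boxplus> \<Phi> (\<lambda>x. x))"
    using F F_id by (simp add: GHA.diff_add_cancel_right)
  also have "\<dots> = B \<odot> A \<boxminus> \<Phi> ?p"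
    unfolding gha_commutator fun_shift using F f_in_F by (simp add: GHA.diff_add_cancel_right)
  finally show ?thesis by (simp add: gha_factor_def)
qed

end


section \<open>The product formula\<close>

theorem theorem3p1:
  fixes D :: "complex set" and F :: "(complex \<Rightarrow> complex) set"
    and f fi :: "complex \<Rightarrow> complex" and k :: nat
  assumes "gha_setting D F f fi"
    and "k > 0"
  shows "(gha_adag D F f [^]\<^bsub>GHA D F f\<^esub> k) \<otimes>\<^bsub>GHA D F f\<^esub> (gha_a D F f [^]\<^bsub>GHA D F f\<^esub> k) =
           list_prod (GHA D F f) (map (\<lambda>l. gha_factor D F f fi (int l)) (rev [1..<k]))
             \<otimes>\<^bsub>GHA D F f\<^esub> (gha_adag D F f \<otimes>\<^bsub>GHA D F f\<^esub> gha_a D F f)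
       \<and> (\<forall>ls. distinct ls \<and> set ls = {0..<k} \<longrightarrow>
           (gha_adag D F f [^]\<^bsub>GHA D F f\<^esub> k) \<otimes>\<^bsub>GHA D F f\<^esub> (gha_a D F f [^]\<^bsub>GHA D F f\<^esub> k) =
             list_prod (GHA D F f) (map (\<lambda>l. gha_factor D F f fi (int l)) ls))"
proof -
  interpret gha_setting D F f fi by fact
  have main: "(B [^]\<^bsub>GHA D F f\<^esub> k) \<odot> (A [^]\<^bsub>GHA D F f\<^esub> k)
      = list_prod (GHA D F f) (map L (rev [0..<k]))"
    by (rule GHA.pow_mult_pow_eq_list_prod)
      (simp_all add: gha_factor_0[simplified] gha_factor_raise del: of_nat_Suc)
  have "rev [0..<k] = rev [1..<k] @ [0]"
    using assms(2) by (simp add: upt_rec[of 0 k])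
  then have "list_prod (GHA D F f) (map L (rev [0..<k]))
      = list_prod (GHA D F f) (map L (rev [1..<k])) \<odot> list_prod (GHA D F f) [L 0]"
    by (simp only: map_append list.map) (rule GHA.list_prod_append; use gha_factor_closed[of 0] in auto)
  then have "list_prod (GHA D F f) (map L (rev [0..<k]))
      = list_prod (GHA D F f) (map L (rev [1..<k])) \<odot> (B \<odot> A)"
    using gha_factor_0 by simp
  moreover have "list_prod (GHA D F f) (map L (rev [0..<k])) = list_prod (GHA D F f) (map L ls)"
    if "distinct ls" "set ls = {0..<k}" for ls
  proof (rule GHA.list_prod_mset_cong)
    have "mset (rev [0..<k]) = mset ls"
      using that by (subst set_eq_iff_mset_eq_distinct[symmetric]) auto
    then show "mset (map L (rev [0..<k])) = mset (map L ls)"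
      by (simp only: mset_map)
  qed (auto simp: gha_factor_comm)
  ultimately show ?thesis
    using main by metis
qed

end
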